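(* Suppose that a region $A\subseteq\mathbb{R}^d$ is defined by a differentiable function $\alpha$, i.e. $A:=\{x:\alpha(x)\le 0\}$ and $\partial A:=\{x:\alpha(x)=0\}$. Moreover, suppose that $A$ is connected. Then a point $x$ is inside $A$ if $$x=x^\star-\|x-x^\star\|\,\frac{D_x\alpha(x)\big|_{x=x^\star}}{\big\|D_x\alpha(x)\big|_{x=x^\star}\big\|},$$ where $x^\star:=\operatorname*{arg\,min}_{y\in\partial A}\|x-y\|$. If instead $$x=x^\star+\|x-x^\star\|\,\frac{D_x\alpha(x)\big|_{x=x^\star}}{\big\|D_x\alpha(x)\big|_{x=x^\star}\big\|},$$ then $x$ is outside $A$.
   Context: $\|\cdot\|$ is the Euclidean norm on $\mathbb{R}^d$, and $D_x\alpha(x)\big|_{x=x^\star}$ is the gradient of $\alpha$ at the point $x^\star$ of $\partial A$ at minimal distance from $x$.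
   Formalization: The second claim is stated only for points x not on the boundary ∂A: if α(x)=0 then x=x*, the equation with the plus sign holds trivially, yet x belongs to A, so the claim as written fails there. *)

theory Defs
  imports "HOL-Analysis.Analysis"
begin

definition region :: "(real ^ 'd \<Rightarrow> real) \<Rightarrow> (real ^ 'd) set" where
  "region \<alpha> = {x. \<alpha> x \<le> 0}"

(* The boundary is by definition the zero set of \<alpha>; it is not assumed to coincide with the
   topological frontier of the region. It is contained in the region. *)
definition region_boundary :: "(real ^ 'd \<Rightarrow> real) \<Rightarrow> (real ^ 'd) set" where
  "region_boundary \<alpha> = {x. \<alpha> x = 0}"

end

theory Submission
  imports Defs
begin

text \<open>If \<open>x\<close> lies in the direction of \<open>-g\<close> as seen from the zero \<open>xs\<close>, then \<open>\<alpha>\<close> is negative on an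
  initial piece of the segment from \<open>xs\<close> to \<open>x\<close>. Were \<open>\<alpha>\<close> positive at \<open>x\<close>, the intermediate value
  theorem would give a zero of \<open>\<alpha>\<close> inside the segment, hence closer to \<open>x\<close> than \<open>xs\<close>. The second
  half is the same argument for \<open>-\<alpha>\<close>. If \<open>g = 0\<close>, the normalised gradient is \<open>0\<close> by the convention
  for division by zero, so that \<open>x = xs\<close> and both claims are trivial.\<close>

lemma closer_zero_if_gderiv_neg:
  fixes f :: "'a::real_inner \<Rightarrow> real"
  assumes cont: "continuous_on UNIV f" and grad: "GDERIV f a :> g"
    and fa: "f a = 0" and fx: "f x > 0" and neg: "inner g (x - a) < 0"
  shows "\<exists>y. f y = 0 \<and> norm (x - y) < norm (x - a)"
proof -
  define \<phi> where "\<phi> t = f (a + t *\<^sub>R (x - a))" for t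
  have "((\<lambda>t. a + t *\<^sub>R (x - a)) has_derivative (\<lambda>t. t *\<^sub>R (x - a))) (at 0)"
    by (auto intro!: derivative_eq_intros)
  moreover have "(f has_derivative (\<lambda>h. inner h g)) (at (a + 0 *\<^sub>R (x - a)))"
    using grad by (simp add: gderiv_def)
  ultimately have "(\<phi> has_derivative (\<lambda>t. inner (t *\<^sub>R (x - a)) g)) (at 0)"
    unfolding \<phi>_def by (rule has_derivative_compose)
  then have "DERIV \<phi> 0 :> inner g (x - a)"
    by (simp add: has_field_derivative_def inner_commute mult_commute_abs)
  then obtain d where d: "d > 0" "\<And>h. 0 < h \<Longrightarrow> h < d \<Longrightarrow> \<phi> (0 + h) < \<phi> 0"
    using DERIV_neg_dec_right neg by blast
  \<comment> \<open>Halving \<open>d\<close> makes \<open>h < d\<close> strict, and the cap 1 keeps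
    \<open>h\<close> on the segment. Applying the intermediate value theorem from \<open>h\<close>
    rather than 0 avoids the known zero \<open>t = 0\<close>, so the zero found is strictly closer
    to \<open>x\<close>.\<close>
  define h where "h = min (d / 2) 1"
  have h: "0 < h" "h < d" "h \<le> 1"
    using d(1) by (auto simp: h_def)
  have "\<phi> h \<le> 0" "0 \<le> \<phi> 1"
    using d(2)[of h] h fa fx by (auto simp: \<phi>_def)
  moreover have "continuous_on {h..1} \<phi>"
    unfolding \<phi>_def
    by (intro continuous_on_compose2[OF cont] continuous_intros) auto
  ultimately obtain t where t: "h \<le> t" "t \<le> 1" "\<phi> t = 0"
    using IVT'[of \<phi> h 0 1] h by blast
  have "x - (a + t *\<^sub>R (x - a)) = (1 - t) *\<^sub>R (x - a)"
    by (simp add: algebra_simps)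
  then have "norm (x - (a + t *\<^sub>R (x - a))) = (1 - t) * norm (x - a)"
    using t by simp
  also have "\<dots> < norm (x - a)"
  proof -
    have "norm (x - a) > 0"
      using neg by auto
    then show ?thesis
      using t h by simp
  qed
  finally show ?thesis
    using t by (auto simp: \<phi>_def)
qed

text \<open>If \<open>f x > 0\<close>, then \<open>x \<noteq> a\<close> and
  \<open>g \<noteq> 0\<close>, so \<open>x - a\<close> is a negative multiple of \<open>g\<close>
  and the closer zero contradicts \<open>min\<close>. A general \<open>f\<close> allows both
  \<alpha> and its negative.\<close>

lemma nonpos_if_opposite_gradient:
  fixes f :: "'a::real_inner \<Rightarrow> real"
  assumes "continuous_on UNIV f" and "GDERIV f a :> g" and "f a = 0"
    and min: "\<And>y. f y = 0 \<Longrightarrow> norm (x - a) \<le> norm (x - y)"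
    and x: "x = a - norm (x - a) *\<^sub>R (g /\<^sub>R norm g)"
  shows "f x \<le> 0"
proof (rule ccontr)
  assume "\<not> f x \<le> 0"
  then have "f x > 0" by simp
  with \<open>f a = 0\<close> have "x \<noteq> a" by auto
  with x have "g \<noteq> 0" by auto
  have "x - a = - (norm (x - a) / norm g) *\<^sub>R g"
    by (subst x) (simp add: divide_inverse)
  then have "inner g (x - a) = - (norm (x - a) / norm g) * inner g g"
    by (metis inner_scaleR_right)
  also have "\<dots> < 0"
    using \<open>g \<noteq> 0\<close> \<open>x \<noteq> a\<close> by simp
  finally show False
    using closer_zero_if_gderiv_neg assms(1-3) \<open>f x > 0\<close> min by (metis not_le)
qed

theorem proposition1:
  fixes \<alpha> :: "real ^ 'd \<Rightarrow> real" and x xs g :: "real ^ 'd"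
  assumes "\<alpha> differentiable_on UNIV"
    and "connected (region \<alpha>)"
    and "is_arg_min (\<lambda>y. norm (x - y)) (\<lambda>y. y \<in> region_boundary \<alpha>) xs"
    and "GDERIV \<alpha> xs :> g"
  shows "(x = xs - norm (x - xs) *\<^sub>R (g /\<^sub>R norm g) \<longrightarrow> x \<in> region \<alpha>) \<and>
         (x \<notin> region_boundary \<alpha> \<and> x = xs + norm (x - xs) *\<^sub>R (g /\<^sub>R norm g) \<longrightarrow> x \<notin> region \<alpha>)"
proof -
  have cont: "continuous_on UNIV \<alpha>"
    using assms(1) by (rule differentiable_imp_continuous_on)
  have zero: "\<alpha> xs = 0" and min: "\<And>y. \<alpha> y = 0 \<Longrightarrow> norm (x - xs) \<le> norm (x - y)"
    using assms(3) by (auto simp: is_arg_min_linorder region_boundary_def)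
  have "\<alpha> x \<le> 0" if "x = xs - norm (x - xs) *\<^sub>R (g /\<^sub>R norm g)"
    using nonpos_if_opposite_gradient[OF cont assms(4) zero min that] .
  \<comment> \<open>Strictness cannot be had here: \<open>x = xs\<close> satisfies the equation. The
    premise \<open>x \<notin> region_boundary \<alpha>\<close> then rules out
    \<open>\<alpha> x = 0\<close>.\<close>
  moreover have "- \<alpha> x \<le> 0" if "x = xs + norm (x - xs) *\<^sub>R (g /\<^sub>R norm g)"
  proof (rule nonpos_if_opposite_gradient[where f = "\<lambda>y. - \<alpha> y"])
    show "continuous_on UNIV (\<lambda>y. - \<alpha> y)"
      using cont by (rule continuous_on_minus)
    show "GDERIV (\<lambda>y. - \<alpha> y) xs :> - g"
      using assms(4) by (rule GDERIV_minus)
    show "x = xs - norm (x - xs) *\<^sub>R (- g /\<^sub>R norm (- g))"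
      using that by simp
  qed (use zero min in auto)
  ultimately show ?thesis
    by (auto simp: region_def region_boundary_def)
qed

end
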